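(* Let $n\ge1$. (1) $\xi_{2n+1}\equiv\mathsf{slang}_1(\mathsf{sa}_{2n+1})\bmod \mathsf{ARI}_{\ge4}$. Consequently \[ \sigma^c_{2n+1}-\mathsf{luma}_{2n+1}\equiv\sum_{\substack{a+b=n\\ a,b\ge1}}\frac{B_{2a}B_{2b}}{24\,b\,B_{2n}}\binom{2n}{2a}D_{a,b}\bmod\mathsf{ARI}_{\ge4}, \] where $D_{a,b}:=\mathsf{ari}(\mathsf{sa}_{2a+1},\mathsf{ari}(\mathsf{sa}_{2b+1},\mathsf{sa}_{-1}))+2b\,\mathsf{ari}(\mathsf{slang}_1(\mathsf{sa}_{2a+1}),\mathsf{slang}_2(\mathsf{sa}_{2b}))\in\mathsf{ARI}_{\ge3}$. (2) For each such $a,b$, the length-three component $D_{a,b}^{3}(x_1,x_2,x_3)$ lies in $\mathbb{Q}[x_1,x_2,x_3]$.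
   Context: Moulds: $M=(M^m(x_1,\dots,x_m))_{m\ge0}$ with $M^m\in\mathbb{Q}((x_1,\dots,x_m))$ (fraction field of $\mathbb{Q}[[x_1,\dots,x_m]]$); $M(\omega):=M^m(w_1,\dots,w_m)$ for a word $\omega=(w_1,\dots,w_m)$ of $\mathbb{Z}$-linear forms. Product $(M\times N)^m=\sum_{k}M^k(x_1,\dots,x_k)N^{m-k}(x_{k+1},\dots,x_m)$, unit $1$. $\mathsf{ARI}$: $M^0=0$; $\mathsf{ARI}_{\ge k}$: $M^m=0$ for $m<k$; $\mathsf{GARI}$: $M^0=1$. For an integer $s$, $\mathsf{sa}_s$ is the mould with $\mathsf{sa}_s^1(u)=u^{s-1}$ and $0$ in other lengths. $B_m$ are Bernoulli numbers, $\frac{x}{e^x-1}=\sum B_mx^m/m!$. Flexions: for nonempty $\alpha=(a_1,\dots,a_m)$, $\beta=(b_1,\dots,b_n)$: $\lceil\beta\rceil\alpha=(b_1+\cdots+b_n+a_1,a_2,\dots,a_m)$, $\alpha\lfloor\beta\rfloor=(a_1,\dots,a_{m-1},a_m+b_1+\cdots+b_n)$; $\lceil\emptyset\rceil\gamma=\gamma\lfloor\emptyset\rfloor=\gamma$, $\lceil\gamma\rceil\emptyset=\emptyset\lfloor\gamma\rfloor=\emptyset$; $\lceil a\rceil b\lfloor c\rfloor$ ($b\neq\emptyset$) is $b$ with first entry increased by the sum of $a$ and last entry by the sum of $c$. $\mathsf{arit}(N)(M)$: $0$ in lengths $0,1$; for $m\ge2$, $\sum_{\alpha\beta\gamma=(x_1..x_m),\beta,\gamma\ne\emptyset}M(\alpha\lceil\beta\rceil\gamma)N(\beta)-\sum_{\alpha\beta\gamma,\alpha,\beta\ne\emptyset}M(\alpha\lfloor\beta\rfloor\gamma)N(\beta)$.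 $\mathsf{preari}(M,N)=\mathsf{arit}(N)(M)+M\times N$, $\mathsf{ari}(M,N)=\mathsf{preari}(M,N)-\mathsf{preari}(N,M)$. $\mathsf{preari}_0(A)=1$, $\mathsf{preari}_n(A)=\mathsf{preari}(\mathsf{preari}_{n-1}(A),A)$ ($\mathsf{preari}_1(A)=A$), $\mathsf{expari}(A)=\sum_n\mathsf{preari}_n(A)/n!$, bijective $\mathsf{ARI}\to\mathsf{GARI}$ with inverse $\mathsf{logari}$. $\mathsf{garit}(T)(S)$: $1$ in length $0$; for $m\ge1$, $\sum_{s\ge1}\sum S(\lceil a_1\rceil b_1\lfloor c_1\rfloor\cdots\lceil a_s\rceil b_s\lfloor c_s\rfloor)T(a_1)\cdots T(a_s)T^{\times-1}(c_1)\cdots T^{\times-1}(c_s)$ over $(x_1,\dots,x_m)=a_1b_1c_1\cdots a_sb_sc_s$, $b_i\ne\emptyset$, $c_ia_{i+1}\ne\emptyset$ ($i<s$). $\mathsf{gari}(S,T)=\mathsf{garit}(T)(S)\times T$ (group law on $\mathsf{GARI}$, inverse $\mathsf{invgari}$). $\mathsf{adari}(S)(A)=\mathsf{logari}(\mathsf{gari}(\mathsf{gari}(S,\mathsf{expari}A),\mathsf{invgari}S))$; $\mathsf{adari}(S)^{-1}=\mathsf{adari}(\mathsf{invgari}S)$. $\mathsf{neg}(M)^m(x_1..x_m)=M^m(-x_1,..,-x_m)$; $\mathsf{paj}^m=1/(x_1(x_1+x_2)\cdots(x_1+\cdots+x_m))$, $\mathsf{paj}^0=1$; $\mathsf{sang}(M)=\frac12(\mathrm{id}+\mathsf{neg}\circ\mathsf{adari}(\mathsf{paj}))(\mathsf{paj}^{\times-1}\times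 M\times\mathsf{paj})$. $\mathsf{dupal}^m=\frac{B_m}{m!}\frac{1}{x_1\cdots x_m}\sum_{k=0}^{m-1}(-1)^k\binom{m-1}{k}x_{k+1}$ ($m\ge1$), $\mathsf{dupal}^0=0$; $\mathsf{pal}\in\mathsf{GARI}$ is the unique mould with $(x_1+\cdots+x_m)\mathsf{pal}^m=(\mathsf{pal}\times\mathsf{dupal})^m$ for $m\ge1$. $\mathsf{leng}_r(M)^m=\delta_{m,r}M^m$. $\mathsf{slang}_r(A)=\mathsf{adari}(\mathsf{pal})\circ\mathsf{leng}_r\circ\mathsf{adari}(\mathsf{pal})^{-1}\circ\mathsf{sang}(A)$. $s'$ is the mould with $s'^1(u_1)=\frac1{2u_1}$, $s'^2(u_1,u_2)=\frac1{12}\big(\frac1{x_1x_2}+\frac1{x_2(x_1-x_2)}\big)$ where $x_1=u_1,x_2=u_1+u_2$, and $0$ in other lengths. For $S$ concentrated in length $1$, $\xi'(S)=S+\mathsf{ari}(S,s')+\frac12\mathsf{ari}(\mathsf{ari}(S,s'),s')$ mod $\mathsf{ARI}_{\ge4}$, and $\xi_{2n+1}=\xi'(\mathsf{sa}_{2n+1})$. Modulo $\mathsf{ARI}_{\ge4}$: $\sigma^c_{2n+1}\equiv\xi_{2n+1}+\sum_{a+b=n,\,a,b\ge1}\frac1{24b}\frac{B_{2a}B_{2b}}{B_{2n}}\binom{2n}{2a}\mathsf{ari}(\mathsf{sa}_{2a+1},\mathsf{ari}(\mathsf{sa}_{2b+1},\mathsf{sa}_{-1}))$ and $\mathsf{luma}_{2n+1}\equiv\mathsf{slang}_1(\mathsf{sa}_{2n+1})-\frac1{12}\sum_{a+b=n,\,a,b\ge1}\frac{B_{2a}B_{2b}}{B_{2n}}\binom{2n}{2a}\mathsf{ari}(\mathsf{slang}_1(\mathsf{sa}_{2a+1}),\mathsf{slang}_2(\mathsf{sa}_{2b}))$.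 *)

theory Defs
  imports Complex_Main "HOL-Computational_Algebra.Formal_Power_Series"
begin

text \<open>A mould M = (M^m)_m is represented by a single function on finite lists of reals:
  M xs = M^m(x_1,..,x_m) where m = length xs.  Evaluating a mould on a word of linear forms
  is then just evaluation at the list of values of these forms.  Identities between the
  rational-function components are understood generically (see gen_eq).\<close>

type_synonym mould = "real list \<Rightarrow> real"

definition bern :: "nat \<Rightarrow> real" where
  "bern m = fact m * fps_nth (fps_X / (fps_exp 1 - 1)) m"

definition qpoly :: "nat \<Rightarrow> (real list \<Rightarrow> real) \<Rightarrow> bool" where
  "qpoly m p \<longleftrightarrow> (\<exists>S c. finite S \<and> (\<forall>e\<in>S. length e = m) \<and>
     (\<forall>xs. length xs = m \<longrightarrow>
        p xs = (\<Sum>e\<in>S. of_rat (c e) * (\<Prod>i<m. (xs ! i) ^ (e ! i)))))"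

text \<open>Two length-m components are equal as rational functions iff they agree outside the
  zero set of some nonzero polynomial.\<close>
definition gen_eq :: "nat \<Rightarrow> mould \<Rightarrow> mould \<Rightarrow> bool" where
  "gen_eq m f g \<longleftrightarrow> (\<exists>p. qpoly m p \<and> (\<exists>xs. length xs = m \<and> p xs \<noteq> 0) \<and>
     (\<forall>xs. length xs = m \<and> p xs \<noteq> 0 \<longrightarrow> f xs = g xs))"

definition cong_ari :: "nat \<Rightarrow> mould \<Rightarrow> mould \<Rightarrow> bool" where
  "cong_ari k M N \<longleftrightarrow> (\<forall>m<k. gen_eq m M N)"

definition in_ari_ge :: "nat \<Rightarrow> mould \<Rightarrow> bool" where
  "in_ari_ge k M \<longleftrightarrow> M [] = 0 \<and> (\<forall>m<k. gen_eq m M (\<lambda>_. 0))"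

definition comp_is_qpoly :: "nat \<Rightarrow> mould \<Rightarrow> bool" where
  "comp_is_qpoly m M \<longleftrightarrow> (\<exists>p. qpoly m p \<and> gen_eq m M p)"

definition madd :: "mould \<Rightarrow> mould \<Rightarrow> mould" where
  "madd M N = (\<lambda>xs. M xs + N xs)"

definition msub :: "mould \<Rightarrow> mould \<Rightarrow> mould" where
  "msub M N = (\<lambda>xs. M xs - N xs)"

definition mscale :: "real \<Rightarrow> mould \<Rightarrow> mould" where
  "mscale c M = (\<lambda>xs. c * M xs)"

definition msum :: "'i set \<Rightarrow> ('i \<Rightarrow> mould) \<Rightarrow> mould" where
  "msum I F = (\<lambda>xs. \<Sum>i\<in>I. F i xs)"

definition mone :: mould where
  "mone xs = (if xs = [] then 1 else 0)"

definition mu :: "mould \<Rightarrow> mould \<Rightarrow> mould" where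
  "mu M N = (\<lambda>xs. \<Sum>k\<le>length xs. M (take k xs) * N (drop k xs))"

fun comps :: "'a list \<Rightarrow> 'a list list list" where
  "comps [] = [[]]"
| "comps (x # xs) = map (\<lambda>c. [x] # c) (comps xs) @
      map (\<lambda>c. (x # hd c) # tl c) (filter (\<lambda>c. c \<noteq> []) (comps xs))"

text \<open>multiplicative inverse T^{\<times>-1} (for T with T [] = 1)\<close>
definition invmu :: "mould \<Rightarrow> mould" where
  "invmu T = (\<lambda>xs. \<Sum>c\<leftarrow>comps xs. (-1) ^ length c * (\<Prod>b\<leftarrow>c. T b))"

definition lflex :: "real list \<Rightarrow> real list \<Rightarrow> real list" where
  "lflex b c = (if c = [] then [] else (sum_list b + hd c) # tl c)"

definition rflex :: "real list \<Rightarrow> real list \<Rightarrow> real list" where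
  "rflex a b = (if a = [] then [] else butlast a @ [last a + sum_list b])"

definition flex3 :: "real list \<Rightarrow> real list \<Rightarrow> real list \<Rightarrow> real list" where
  "flex3 a b c = rflex (lflex a b) c"

definition splits3 :: "'a list \<Rightarrow> ('a list \<times> 'a list \<times> 'a list) list" where
  "splits3 xs = [(take i xs, take (j - i) (drop i xs), drop j xs).
                  i \<leftarrow> [0..<Suc (length xs)], j \<leftarrow> [i..<Suc (length xs)]]"

definition arit :: "mould \<Rightarrow> mould \<Rightarrow> mould" where
  "arit N M = (\<lambda>xs. if length xs < 2 then 0 else
     (\<Sum>(a, b, c)\<leftarrow>splits3 xs.
        (if b \<noteq> [] \<and> c \<noteq> [] then M (a @ lflex b c) * N b else 0)
      - (if a \<noteq> [] \<and> b \<noteq> [] then M (rflex a b @ c) * N b else 0)))"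

definition preari :: "mould \<Rightarrow> mould \<Rightarrow> mould" where
  "preari M N = madd (arit N M) (mu M N)"

definition ari :: "mould \<Rightarrow> mould \<Rightarrow> mould" where
  "ari M N = msub (preari M N) (preari N M)"

fun preari_pow :: "nat \<Rightarrow> mould \<Rightarrow> mould" where
  "preari_pow 0 A = mone"
| "preari_pow (Suc n) A = preari (preari_pow n A) A"

text \<open>For A \<in> ARI, preari_n(A) vanishes in lengths < n, so the series defining expari
  is finite in each length.\<close>
definition expari :: "mould \<Rightarrow> mould" where
  "expari A = (\<lambda>xs. \<Sum>n\<le>length xs. preari_pow n A xs / fact n)"

definition logari :: "mould \<Rightarrow> mould" where
  "logari S = (THE A. A [] = 0 \<and> expari A = S)"

definition gdecs :: "real list \<Rightarrow> (real list \<times> real list \<times> real list) list set" where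
  "gdecs xs = {ts. ts \<noteq> [] \<and> concat (map (\<lambda>(a, b, c). a @ b @ c) ts) = xs \<and>
      (\<forall>t\<in>set ts. fst (snd t) \<noteq> []) \<and>
      (\<forall>i. Suc i < length ts \<longrightarrow> snd (snd (ts ! i)) @ fst (ts ! Suc i) \<noteq> [])}"

definition garit :: "mould \<Rightarrow> mould \<Rightarrow> mould" where
  "garit T S = (\<lambda>xs. if xs = [] then 1 else
     (\<Sum>ts\<in>gdecs xs. S (concat (map (\<lambda>(a, b, c). flex3 a b c) ts)) *
        (\<Prod>(a, b, c)\<leftarrow>ts. T a * invmu T c)))"

definition gari :: "mould \<Rightarrow> mould \<Rightarrow> mould" where
  "gari S T = mu (garit T S) T"

definition invgari :: "mould \<Rightarrow> mould" where
  "invgari S = (THE T. gari S T = mone)"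

definition adari :: "mould \<Rightarrow> mould \<Rightarrow> mould" where
  "adari S A = logari (gari (gari S (expari A)) (invgari S))"

definition neg :: "mould \<Rightarrow> mould" where
  "neg M = (\<lambda>xs. M (map uminus xs))"

definition paj :: mould where
  "paj xs = 1 / (\<Prod>k\<in>{1..length xs}. sum_list (take k xs))"

definition sang :: "mould \<Rightarrow> mould" where
  "sang M = (let X = mu (mu (invmu paj) M) paj in
             mscale (1/2) (madd X (neg (adari paj X))))"

definition dupal :: mould where
  "dupal xs = (if xs = [] then 0 else
     bern (length xs) / fact (length xs) * (1 / prod_list xs) *
       (\<Sum>k<length xs. (-1) ^ k * of_nat (length xs - 1 choose k) * xs ! k))"

text \<open>pal: the unique P with P [] = 1 and (x_1+..+x_m) P^m = (P \<times> dupal)^m (m \<ge> 1);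
  since dupal^0 = 0, this is the recursion below.\<close>
function pal :: mould where
  "pal xs = (if xs = [] then 1 else
     (\<Sum>k<length xs. pal (take k xs) * dupal (drop k xs)) / sum_list xs)"
  by auto
termination
  by (relation "measure length") auto

definition leng :: "nat \<Rightarrow> mould \<Rightarrow> mould" where
  "leng r M = (\<lambda>xs. if length xs = r then M xs else 0)"

definition slang :: "nat \<Rightarrow> mould \<Rightarrow> mould" where
  "slang r A = adari pal (leng r (adari (invgari pal) (sang A)))"

definition sa :: "int \<Rightarrow> mould" where
  "sa s = (\<lambda>xs. if length xs = 1 then hd xs powi (s - 1) else 0)"

definition sprime :: mould where
  "sprime xs = (if length xs = 1 then 1 / (2 * xs ! 0)
     else if length xs = 2 then
       (let x1 = xs ! 0; x2 = xs ! 0 + xs ! 1 in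
          1/12 * (1 / (x1 * x2) + 1 / (x2 * (x1 - x2))))
     else 0)"

definition xiprime :: "mould \<Rightarrow> mould" where
  "xiprime S = madd (madd S (ari S sprime)) (mscale (1/2) (ari (ari S sprime) sprime))"

definition xi :: "nat \<Rightarrow> mould" where
  "xi n = xiprime (sa (2 * int n + 1))"

definition Dab :: "nat \<Rightarrow> nat \<Rightarrow> mould" where
  "Dab a b = madd (ari (sa (2 * int a + 1)) (ari (sa (2 * int b + 1)) (sa (-1))))
                  (mscale (2 * real b) (ari (slang 1 (sa (2 * int a + 1))) (slang 2 (sa (2 * int b)))))"

end

theory Submission
  imports Defs "HOL-Computational_Algebra.Polynomial"
begin

text \<open>
  Put \<open>P = -s'\<close>. Up to length two, \<open>pal = expari P\<close>, so up to length three \<open>adari pal A\<close> for \<open>A\<close>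
  concentrated in length one is \<open>A + ari P A + 1/2 ari P (ari P A)\<close>, which is \<open>\<xi>'(A)\<close>; and
  \<open>slang 1 A = adari pal A\<close> for even \<open>A\<close>.

  For (2), \<open>sang (sa (2b))\<close> vanishes in length one, so the length-two part of \<open>slang 2 (sa (2b))\<close> is
  that of \<open>sang (sa (2b))\<close>, and \<open>D\<close> is in length three the bracket of \<open>sa (2a+1)\<close> with
  \<open>ari (sa (2b+1)) (sa (-1)) + 2b slang 2 (sa (2b))\<close>. The latter is already a polynomial in
  length two: it equals \<open>T(x,y) - T(y,x) - T(x+y,-y)\<close>, where
  \<open>h^2 T(h,y) = (y+h)^(2b) - y^(2b) - b h (y^(2b-1) + (y+h)^(2b-1))\<close> has no linear term in \<open>h\<close>.
\<close>

section \<open>Polynomial functions and generic equality\<close>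

lemma qpoly_cong:
  assumes "qpoly m p" "\<And>xs. length xs = m \<Longrightarrow> p xs = q xs"
  shows "qpoly m q"
  using assms unfolding qpoly_def by auto

lemma qpoly_monom:
  assumes "length e = m"
  shows "qpoly m (\<lambda>xs. of_rat c * (\<Prod>i<m. (xs ! i) ^ (e ! i)))"
  unfolding qpoly_def by (rule exI[of _ "{e}"], rule exI[of _ "\<lambda>_. c"]) (use assms in simp)

lemma qpoly_add:
  assumes "qpoly m p" "qpoly m q"
  shows "qpoly m (\<lambda>xs. p xs + q xs)"
proof -
  obtain S c where S: "finite S" "\<forall>e\<in>S. length e = m"
      "\<And>xs. length xs = m \<Longrightarrow> p xs = (\<Sum>e\<in>S. of_rat (c e) * (\<Prod>i<m. (xs ! i) ^ (e ! i)))"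
    using assms(1) unfolding qpoly_def by auto
  obtain T d where T: "finite T" "\<forall>e\<in>T. length e = m"
      "\<And>xs. length xs = m \<Longrightarrow> q xs = (\<Sum>e\<in>T. of_rat (d e) * (\<Prod>i<m. (xs ! i) ^ (e ! i)))"
    using assms(2) unfolding qpoly_def by auto
  \<comment> \<open>The two supports may overlap, so both coefficient families are extended by zero
    to the union.\<close>
  define k where "k e = (if e \<in> S then c e else 0) + (if e \<in> T then d e else 0)" for e
  have "p xs + q xs = (\<Sum>e\<in>S \<union> T. of_rat (k e) * (\<Prod>i<m. (xs ! i) ^ (e ! i)))"
    if "length xs = m" for xs
  proof -
    have "p xs = (\<Sum>e\<in>S \<union> T. of_rat (if e \<in> S then c e else 0) * (\<Prod>i<m. (xs ! i) ^ (e ! i)))"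
      unfolding S(3)[OF that] using S(1) T(1) by (intro sum.mono_neutral_cong_left) auto
    moreover have "q xs = (\<Sum>e\<in>S \<union> T. of_rat (if e \<in> T then d e else 0) * (\<Prod>i<m. (xs ! i) ^ (e ! i)))"
      unfolding T(3)[OF that] using S(1) T(1) by (intro sum.mono_neutral_cong_left) auto
    ultimately show ?thesis
      by (simp add: k_def of_rat_add distrib_right sum.distrib)
  qed
  thus ?thesis unfolding qpoly_def
    by (intro exI[of _ "S \<union> T"] exI[of _ k]) (use S(1,2) T(1,2) in auto)
qed

lemma qpoly_const: "qpoly m (\<lambda>_. of_rat c)"
  by (rule qpoly_cong[OF qpoly_monom[of "replicate m 0" m c]]) simp_all

lemma qpoly_of_nat: "qpoly m (\<lambda>_. of_nat k)"
  using qpoly_const[of m "of_nat k"] by simp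

lemma qpoly_sum:
  assumes "finite S" "\<And>s. s \<in> S \<Longrightarrow> qpoly m (p s)"
  shows "qpoly m (\<lambda>xs. \<Sum>s\<in>S. p s xs)"
  using assms
proof (induction S rule: finite_induct)
  case empty
  show ?case using qpoly_of_nat[of m 0] by simp
qed (simp add: qpoly_add)

text \<open>Exponent vectors add componentwise; coinciding sums in the double sum are merged by
  \<open>qpoly_sum\<close>.\<close>

lemma qpoly_mult:
  assumes "qpoly m p" "qpoly m q"
  shows "qpoly m (\<lambda>xs. p xs * q xs)"
proof -
  obtain S c where S: "finite S" "\<forall>e\<in>S. length e = m"
      "\<And>xs. length xs = m \<Longrightarrow> p xs = (\<Sum>e\<in>S. of_rat (c e) * (\<Prod>i<m. (xs ! i) ^ (e ! i)))"
    using assms(1) unfolding qpoly_def by auto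
  obtain T d where T: "finite T" "\<forall>e\<in>T. length e = m"
      "\<And>xs. length xs = m \<Longrightarrow> q xs = (\<Sum>e\<in>T. of_rat (d e) * (\<Prod>i<m. (xs ! i) ^ (e ! i)))"
    using assms(2) unfolding qpoly_def by auto
  let ?add = "\<lambda>e f. map2 (+) e f"
  have "qpoly m (\<lambda>xs. \<Sum>e\<in>S. \<Sum>f\<in>T. of_rat (c e * d f) * (\<Prod>i<m. (xs ! i) ^ (?add e f ! i)))"
    using S T by (intro qpoly_sum qpoly_monom) auto
  thus ?thesis
  proof (rule qpoly_cong)
    fix xs :: "real list" assume "length xs = m"
    have "(\<Prod>i<m. (xs ! i) ^ (?add e f ! i)) = (\<Prod>i<m. (xs ! i) ^ (e ! i)) * (\<Prod>i<m. (xs ! i) ^ (f ! i))"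
      if "e \<in> S" "f \<in> T" for e f
      unfolding prod.distrib[symmetric] power_add[symmetric]
      using S(2) T(2) that by (intro prod.cong) auto
    thus "(\<Sum>e\<in>S. \<Sum>f\<in>T. of_rat (c e * d f) * (\<Prod>i<m. (xs ! i) ^ (?add e f ! i))) = p xs * q xs"
      unfolding S(3)[OF \<open>length xs = m\<close>] T(3)[OF \<open>length xs = m\<close>] sum_product
      by (intro sum.cong refl) (simp add: of_rat_mult)
  qed
qed

lemma qpoly_uminus: "qpoly m p \<Longrightarrow> qpoly m (\<lambda>xs. - p xs)"
  using qpoly_mult[OF qpoly_const[of m "- 1"], of p] by (simp add: of_rat_minus)

lemma qpoly_diff: "qpoly m p \<Longrightarrow> qpoly m q \<Longrightarrow> qpoly m (\<lambda>xs. p xs - q xs)"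
  using qpoly_add[OF _ qpoly_uminus, of m p q] by simp

lemma qpoly_power: "qpoly m p \<Longrightarrow> qpoly m (\<lambda>xs. p xs ^ k)"
  using qpoly_of_nat[of m 1] by (induction k) (simp_all add: qpoly_mult)

lemma qpoly_nth:
  assumes "i < m"
  shows "qpoly m (\<lambda>xs. xs ! i)"
proof -
  have "qpoly m (\<lambda>xs. of_rat 1 * (\<Prod>j<m. (xs ! j) ^ ((replicate m 0)[i := 1] ! j)))"
    by (rule qpoly_monom) simp
  thus ?thesis
  proof (rule qpoly_cong)
    fix xs :: "real list"
    have "(\<Prod>j<m. (xs ! j) ^ ((replicate m 0)[i := 1] ! j)) = (\<Prod>j<m. if j = i then xs ! j else 1)"
      by (intro prod.cong refl) (simp add: nth_list_update)
    thus "of_rat 1 * (\<Prod>j<m. (xs ! j) ^ ((replicate m 0)[i := 1] ! j)) = xs ! i"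
      using assms by simp
  qed
qed

lemmas qpoly_intros = qpoly_add qpoly_mult qpoly_diff qpoly_uminus qpoly_power qpoly_of_nat qpoly_nth

text \<open>Every coordinate is affine in \<open>t\<close>, so a monomial becomes a product of
  powers of linear polynomials. This reduces nonvanishing to one variable.\<close>

lemma qpoly_on_line:
  assumes "qpoly m p" "length xs = m" "length ys = m"
  obtains r where "\<And>t. p (map2 (\<lambda>x y. x + t * (y - x)) xs ys) = poly r t"
proof -
  obtain S c where S: "\<And>xs. length xs = m \<Longrightarrow>
      p xs = (\<Sum>e\<in>S. of_rat (c e) * (\<Prod>i<m. (xs ! i) ^ (e ! i)))"
    using assms(1) unfolding qpoly_def by auto
  let ?r = "\<Sum>e\<in>S. smult (of_rat (c e)) (\<Prod>i<m. [:xs ! i, ys ! i - xs ! i:] ^ (e ! i))"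
  have "p (map2 (\<lambda>x y. x + t * (y - x)) xs ys) = poly ?r t" for t
    using assms(2,3) by (simp add: S poly_sum poly_prod)
  thus thesis by (rule that)
qed

text \<open>On the line through a non-zero of \<open>p\<close> and a non-zero of \<open>q\<close>, both restrict to nonzero
  univariate polynomials.\<close>
lemma qpoly_common_nonzero:
  assumes "qpoly m p" "length xs = m" "p xs \<noteq> 0"
    and "qpoly m q" "length ys = m" "q ys \<noteq> 0"
  shows "\<exists>zs. length zs = m \<and> p zs * q zs \<noteq> 0"
proof -
  let ?l = "\<lambda>t. map2 (\<lambda>x y. x + t * (y - x)) xs ys"
  obtain P where P: "\<And>t. p (?l t) = poly P t"
    using qpoly_on_line[OF assms(1,2,5)] by blast
  obtain Q where Q: "\<And>t. q (?l t) = poly Q t"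
    using qpoly_on_line[OF assms(4,2,5)] by blast
  have l: "?l 0 = xs" "?l 1 = ys"
    using assms(2,5) by (auto intro: nth_equalityI)
  have "P \<noteq> 0" using P[of 0] assms(3) unfolding l by auto
  moreover have "Q \<noteq> 0" using Q[of 1] assms(6) unfolding l by auto
  ultimately have "P * Q \<noteq> 0" by simp
  then obtain t where "poly (P * Q) t \<noteq> 0" using poly_all_0_iff_0 by blast
  thus ?thesis using P Q assms(2,5) by (intro exI[of _ "?l t"]) simp
qed

lemma gen_eqI:
  assumes "qpoly m p" "length ys = m" "p ys \<noteq> 0"
    and "\<And>xs. length xs = m \<Longrightarrow> p xs \<noteq> 0 \<Longrightarrow> f xs = g xs"
  shows "gen_eq m f g"
  using assms unfolding gen_eq_def by blast

lemma gen_eq_pointwise: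
  assumes "\<And>xs. length xs = m \<Longrightarrow> f xs = g xs"
  shows "gen_eq m f g"
  using assms by (intro gen_eqI[OF qpoly_of_nat[of m 1], of "replicate m 0"]) auto

text \<open>The product of the two exceptional polynomials serves for the conclusion. The free
  \<open>F\<close> and \<open>G\<close> cover sums, differences and transitivity at once.\<close>

lemma gen_eq_combine:
  assumes "gen_eq m f g" "gen_eq m f' g'"
    and "\<And>xs. length xs = m \<Longrightarrow> f xs = g xs \<Longrightarrow> f' xs = g' xs \<Longrightarrow> F xs = G xs"
  shows "gen_eq m F G"
proof -
  obtain p xs where p: "qpoly m p" "length xs = m" "p xs \<noteq> 0"
      "\<And>xs. length xs = m \<Longrightarrow> p xs \<noteq> 0 \<Longrightarrow> f xs = g xs"
    using assms(1) unfolding gen_eq_def by blast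
  obtain q ys where q: "qpoly m q" "length ys = m" "q ys \<noteq> 0"
      "\<And>xs. length xs = m \<Longrightarrow> q xs \<noteq> 0 \<Longrightarrow> f' xs = g' xs"
    using assms(2) unfolding gen_eq_def by blast
  obtain zs where "length zs = m" "p zs * q zs \<noteq> 0"
    using qpoly_common_nonzero[OF p(1-3) q(1-3)] by blast
  thus ?thesis
    using p q assms(3) by (intro gen_eqI[OF qpoly_mult[OF p(1) q(1)], of zs]) auto
qed

section \<open>Flexion operations in lengths at most three\<close>

lemma mu_Nil [simp]: "mu M N [] = M [] * N []"
  by (simp add: mu_def)

lemma mu_1: "mu M N [x] = M [] * N [x] + M [x] * N []"
  by (simp add: mu_def)

lemma mu_2: "mu M N [x, y] = M [] * N [x, y] + M [x] * N [y] + M [x, y] * N []"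
  by (simp add: mu_def numeral_eq_Suc atMost_Suc)

lemma mu_3: "mu M N [x, y, z] =
    M [] * N [x, y, z] + M [x] * N [y, z] + M [x, y] * N [z] + M [x, y, z] * N []"
  by (simp add: mu_def numeral_eq_Suc atMost_Suc)

lemma arit_short: "length xs < 2 \<Longrightarrow> arit N M xs = 0"
  by (simp add: arit_def)

lemma arit_2: "arit N M [x, y] = M [x + y] * N [x] - M [x + y] * N [y]"
  by (simp add: arit_def splits3_def lflex_def rflex_def upt_rec)

lemma arit_3: "arit N M [x, y, z] =
   M [x + y, z] * N [x] + M [x + y + z] * N [x, y] + M [x, y + z] * N [y]
   - M [x + y, z] * N [y] - M [x + y + z] * N [y, z] - M [x, y + z] * N [z]"
  by (simp add: arit_def splits3_def lflex_def rflex_def upt_rec algebra_simps)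

section \<open>Multiplicative inverses and the word decompositions in \<open>garit\<close>\<close>

lemma invmu_Nil [simp]: "invmu T [] = 1"
  by (simp add: invmu_def)

lemma invmu_1 [simp]: "invmu T [x] = - T [x]"
  by (simp add: invmu_def)

lemma invmu_2 [simp]: "invmu T [x, y] = T [x] * T [y] - T [x, y]"
  by (simp add: invmu_def)


text \<open>Without the junction condition of \<open>gdecs\<close> the tail of a decomposition is
  again a decomposition, of the remaining word, so that short words can be enumerated
  recursively.\<close>

definition triple_decs :: "real list \<Rightarrow> (real list \<times> real list \<times> real list) list set" where
  "triple_decs xs = {ts. concat (map (\<lambda>(a, b, c). a @ b @ c) ts) = xs \<and>
     (\<forall>t\<in>set ts. fst (snd t) \<noteq> [])}"

lemma gdecs_eq: "gdecs xs = {ts \<in> triple_decs xs. ts \<noteq> [] \<and>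
    (\<forall>i. Suc i < length ts \<longrightarrow> snd (snd (ts ! i)) @ fst (ts ! Suc i) \<noteq> [])}"
  by (auto simp: gdecs_def triple_decs_def)

lemma triple_decs_Nil: "triple_decs [] = {[]}"
proof -
  have "ts = []" if "ts \<in> triple_decs []" for ts
    using that by (cases ts) (auto simp: triple_decs_def)
  thus ?thesis by (auto simp: triple_decs_def)
qed

lemma triple_decs_cases:
  assumes "ts \<in> triple_decs xs" "xs \<noteq> []"
  obtains a b c r ts' where "ts = (a, b, c) # ts'" "xs = a @ b @ c @ r" "b \<noteq> []" "ts' \<in> triple_decs r"
  using assms by (cases ts) (auto simp: triple_decs_def)

lemma triple_decs_1: "triple_decs [x] = {[([],[x],[])]}"
proof -
  have "ts = [([],[x],[])]" if "ts \<in> triple_decs [x]" for ts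
    using that
    by (rule triple_decs_cases)
       (auto simp: append_eq_Cons_conv Cons_eq_append_conv triple_decs_Nil)
  thus ?thesis by (auto simp: triple_decs_def)
qed

lemma triple_decs_2: "triple_decs [x, y] =
    {[([],[x,y],[])], [([x],[y],[])], [([],[x],[y])], [([],[x],[]),([],[y],[])]}" (is "_ = ?R")
proof -
  have "ts \<in> ?R" if "ts \<in> triple_decs [x, y]" for ts
    using that
    by (rule triple_decs_cases)
       (auto simp: append_eq_Cons_conv Cons_eq_append_conv triple_decs_Nil triple_decs_1)
  thus ?thesis by (auto simp: triple_decs_def)
qed

lemma append_eq_1: "as @ bs = [x] \<longleftrightarrow> as = [] \<and> bs = [x] \<or> as = [x] \<and> bs = []"
  by (auto simp: append_eq_Cons_conv)

lemma append_eq_2: "as @ bs = [x, y] \<longleftrightarrow>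
    as = [] \<and> bs = [x, y] \<or> as = [x] \<and> bs = [y] \<or> as = [x, y] \<and> bs = []"
  by (auto simp: append_eq_Cons_conv)

lemma append_eq_3: "as @ bs = [x, y, z] \<longleftrightarrow>
    as = [] \<and> bs = [x, y, z] \<or> as = [x] \<and> bs = [y, z] \<or>
    as = [x, y] \<and> bs = [z] \<or> as = [x, y, z] \<and> bs = []"
  by (auto simp: append_eq_Cons_conv)

text \<open>Positions of the first triple, with \<open>r\<close> the word left for later triples:
  six cases with \<open>r\<close> empty, three with one letter, one with two.\<close>

lemma split4_3:
  assumes "a @ b @ c @ r = [x, y, z]" "b \<noteq> []"
  shows "(a, b, c, r) \<in> {([],[x,y,z],[],[]), ([x],[y,z],[],[]), ([],[x,y],[z],[]),
     ([x,y],[z],[],[]), ([x],[y],[z],[]), ([],[x],[y,z],[]),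
     ([],[x,y],[],[z]), ([x],[y],[],[z]), ([],[x],[y],[z]), ([],[x],[],[y,z])}"
  using assms
  by (simp only: append_eq_1 append_eq_2 append_eq_3)
     (elim disjE conjE; simp add: append_eq_1 append_eq_2)

lemma triple_decs_3: "triple_decs [x, y, z] \<subseteq>
    {[([],[x,y,z],[])], [([x],[y,z],[])], [([],[x,y],[z])],
     [([x,y],[z],[])], [([x],[y],[z])], [([],[x],[y,z])],
     [([],[x,y],[]),([],[z],[])], [([x],[y],[]),([],[z],[])], [([],[x],[y]),([],[z],[])],
     [([],[x],[]),([],[y,z],[])], [([],[x],[]),([y],[z],[])], [([],[x],[]),([],[y],[z])],
     [([],[x],[]),([],[y],[]),([],[z],[])]}" (is "_ \<subseteq> ?R")
proof
  fix ts assume "ts \<in> triple_decs [x, y, z]"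
  then obtain a b c r ts' where ts: "ts = (a, b, c) # ts'" "ts' \<in> triple_decs r"
    and "a @ b @ c @ r = [x, y, z]" "b \<noteq> []"
    by (rule triple_decs_cases) auto
  from split4_3[OF this(3,4)] ts show "ts \<in> ?R"
    by (elim insertE emptyE) (auto simp: triple_decs_Nil triple_decs_1 triple_decs_2)
qed

lemma gdecs_1: "gdecs [x] = {[([],[x],[])]}"
  by (auto simp: gdecs_eq triple_decs_1)

lemma gdecs_2: "gdecs [x, y] = {[([],[x,y],[])], [([x],[y],[])], [([],[x],[y])]}"
  by (auto simp: gdecs_eq triple_decs_2)

lemma gdecs_3: "gdecs [x, y, z] =
    {[([],[x,y,z],[])], [([x],[y,z],[])], [([],[x,y],[z])],
     [([x,y],[z],[])], [([x],[y],[z])], [([],[x],[y,z])],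
     [([],[x],[y]),([],[z],[])], [([],[x],[]),([y],[z],[])]}" (is "_ = ?R")
proof
  show "gdecs [x, y, z] \<subseteq> ?R"
  proof
    fix ts assume "ts \<in> gdecs [x, y, z]"
    hence ts: "ts \<in> triple_decs [x, y, z]"
      and C: "\<forall>i. Suc i < length ts \<longrightarrow> snd (snd (ts ! i)) @ fst (ts ! Suc i) \<noteq> []"
      by (auto simp: gdecs_eq)
    \<comment> \<open>The five decompositions to be discarded all violate the junction condition
      between their first two triples.\<close>
    from subsetD[OF triple_decs_3 ts] C[rule_format, of 0] show "ts \<in> ?R"
      by (elim insertE emptyE; simp)
  qed
  show "?R \<subseteq> gdecs [x, y, z]"
    unfolding gdecs_eq triple_decs_def by (intro insert_subsetI empty_subsetI; simp)
qed

lemma garit_1: "T [] = 1 \<Longrightarrow> garit T S [x] = S [x]"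
  by (simp add: garit_def gdecs_1 flex3_def lflex_def rflex_def)

lemma garit_2: "T [] = 1 \<Longrightarrow> garit T S [x, y] = S [x, y] + S [x + y] * (T [x] - T [y])"
  by (simp add: garit_def gdecs_2 flex3_def lflex_def rflex_def algebra_simps)

text \<open>The coefficient of \<open>S [x + y + z]\<close> collects the decompositions whose only
  \<open>b\<close> is a single letter; its products of two values of \<open>T\<close> come from
  \<open>T [x] * invmu T [z]\<close> and \<open>invmu T [y, z]\<close>.\<close>

lemma garit_3: "T [] = 1 \<Longrightarrow> garit T S [x, y, z] =
   S [x, y, z] + S [x + y, z] * (T [x] - T [y]) + S [x, y + z] * (T [y] - T [z])
   + S [x + y + z] * (T [x, y] - T [x] * T [z] + T [y] * T [z] - T [y, z])"
  by (simp add: garit_def gdecs_3 flex3_def lflex_def rflex_def algebra_simps)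

section \<open>Existence of logari and invgari\<close>

lemma splits3_lengths:
  assumes "(a, b, c) \<in> set (splits3 xs)"
  shows "length a + length b + length c = length xs"
  using assms by (auto simp: splits3_def)

lemma length_lflex [simp]: "length (lflex b c) = length c"
  by (cases c) (auto simp: lflex_def)

lemma length_rflex [simp]: "length (rflex a b) = length a"
  by (cases a rule: rev_cases) (auto simp: rflex_def)

text \<open>In a contributing summand \<open>b\<close> is nonempty, so \<open>M\<close> sees a word
  shortened by the length of \<open>b\<close>; one of \<open>a\<close>, \<open>c\<close> is nonempty
  too, so \<open>b\<close> is a proper piece.\<close>

lemma arit_cong:
  assumes "\<And>ys. length ys < length xs \<Longrightarrow> M ys = M' ys"
    and "\<And>ys. length ys < length xs \<Longrightarrow> N ys = N' ys"
  shows "arit N M xs = arit N' M' xs"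
proof -
  have "(\<Sum>(a, b, c)\<leftarrow>splits3 xs.
          (if b \<noteq> [] \<and> c \<noteq> [] then M (a @ lflex b c) * N b else 0)
        - (if a \<noteq> [] \<and> b \<noteq> [] then M (rflex a b @ c) * N b else 0)) =
        (\<Sum>(a, b, c)\<leftarrow>splits3 xs.
          (if b \<noteq> [] \<and> c \<noteq> [] then M' (a @ lflex b c) * N' b else 0)
        - (if a \<noteq> [] \<and> b \<noteq> [] then M' (rflex a b @ c) * N' b else 0))"
  proof (rule arg_cong[of _ _ sum_list], rule map_cong[OF refl], clarify)
    fix a b c assume *: "(a, b, c) \<in> set (splits3 xs)"
    show "(if b \<noteq> [] \<and> c \<noteq> [] then M (a @ lflex b c) * N b else 0)
        - (if a \<noteq> [] \<and> b \<noteq> [] then M (rflex a b @ c) * N b else 0) =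
          (if b \<noteq> [] \<and> c \<noteq> [] then M' (a @ lflex b c) * N' b else 0)
        - (if a \<noteq> [] \<and> b \<noteq> [] then M' (rflex a b @ c) * N' b else 0)"
    proof (cases "b = []")
      case False
      have "M (a @ lflex b c) = M' (a @ lflex b c)" "M (rflex a b @ c) = M' (rflex a b @ c)"
        using splits3_lengths[OF *] False by (auto intro!: assms(1) simp flip: length_greater_0_conv)
      moreover have "N b = N' b" if "a \<noteq> [] \<or> c \<noteq> []"
        using splits3_lengths[OF *] that by (auto intro!: assms(2) simp flip: length_greater_0_conv)
      ultimately show ?thesis by auto
    qed auto
  qed
  thus ?thesis by (simp only: arit_def)
qed

lemma preari_cong:
  assumes "\<And>ys. length ys \<le> length xs \<Longrightarrow> M ys = M' ys"
    and "\<And>ys. length ys \<le> length xs \<Longrightarrow> N ys = N' ys"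
  shows "preari M N xs = preari M' N' xs"
proof -
  have "arit N M xs = arit N' M' xs" using assms by (intro arit_cong) auto
  moreover have "mu M N xs = mu M' N' xs"
    unfolding mu_def using assms by (intro sum.cong) auto
  ultimately show ?thesis by (simp add: preari_def madd_def)
qed

text \<open>The two extreme cuts in \<open>mu\<close>, the only ones that see the whole word, carry
  a factor at the empty word and vanish.\<close>

lemma preari_cong_strict:
  assumes "\<And>ys. length ys < length xs \<Longrightarrow> M ys = M' ys"
    and "\<And>ys. length ys < length xs \<Longrightarrow> N ys = N' ys"
    and "M [] = 0" "M' [] = 0" "N [] = 0" "N' [] = 0"
  shows "preari M N xs = preari M' N' xs"
proof -
  have "arit N M xs = arit N' M' xs" using assms by (intro arit_cong) auto
  moreover have "M (take k xs) * N (drop k xs) = M' (take k xs) * N' (drop k xs)"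
    if "k \<le> length xs" for k
  proof (cases "k = 0 \<or> k = length xs")
    case False
    hence "length (take k xs) < length xs" "length (drop k xs) < length xs"
      using that by auto
    thus ?thesis using assms(1,2) by metis
  qed (use assms in auto)
  hence "mu M N xs = mu M' N' xs"
    unfolding mu_def by (intro sum.cong) auto
  ultimately show ?thesis by (simp add: preari_def madd_def)
qed

lemma preari_Nil: "preari M N [] = M [] * N []"
  by (simp add: preari_def madd_def arit_short)

lemma preari_mone: "preari mone A = A"
proof
  fix xs
  \<comment> \<open>Flexions keep the length, so \<open>mone\<close> receives only nonempty words
    here.\<close>
  have "(\<lambda>(a, b, c).
          (if b \<noteq> [] \<and> c \<noteq> [] then mone (a @ lflex b c) * A b else 0)
        - (if a \<noteq> [] \<and> b \<noteq> [] then mone (rflex a b @ c) * A b else 0)) = (\<lambda>_. 0)"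
    by (auto simp: fun_eq_iff mone_def lflex_def rflex_def)
  hence "arit A mone xs = 0" by (simp add: arit_def)
  moreover have "mu mone A xs = (\<Sum>k\<le>length xs. if k = 0 then A xs else 0)"
    unfolding mu_def by (intro sum.cong) (auto simp: mone_def)
  ultimately show "preari mone A xs = A xs" by (simp add: preari_def madd_def)
qed

lemma preari_pow_Nil: "A [] = 0 \<Longrightarrow> n > 0 \<Longrightarrow> preari_pow n A [] = 0"
  by (cases n) (simp_all add: preari_Nil)

lemma preari_pow_cong:
  assumes "\<And>ys. length ys \<le> length xs \<Longrightarrow> A ys = B ys"
  shows "preari_pow n A xs = preari_pow n B xs"
  using assms
  by (induction n arbitrary: xs) (auto intro!: preari_cong)

text \<open>For \<open>n \<ge> 2\<close> both arguments of the outermost \<open>preari\<close>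
  vanish on the empty word. The power \<open>n = 1\<close> is \<open>A\<close> itself and does
  depend on \<open>A xs\<close>.\<close>

lemma preari_pow_cong_strict:
  assumes "\<And>ys. length ys < length xs \<Longrightarrow> A ys = B ys" "A [] = 0" "B [] = 0" "n \<ge> 2"
  shows "preari_pow n A xs = preari_pow n B xs"
proof -
  obtain m where m: "n = Suc (Suc m)" using \<open>n \<ge> 2\<close> by (metis Suc_le_D numeral_2_eq_2 Suc_le_mono)
  show ?thesis unfolding m preari_pow.simps(2)[of "Suc m"]
    using assms by (intro preari_cong_strict preari_pow_cong preari_pow_Nil) auto
qed

text \<open>Splitting off \<open>n = 0\<close> and \<open>n = 1\<close> exhibits triangularity:
  \<open>A xs\<close> occurs once, and the remaining sum depends on \<open>A\<close> on shorter
  words only.\<close>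

lemma expari_eq:
  assumes "A [] = 0"
  shows "expari A xs = mone xs + A xs + (\<Sum>n\<in>{2..length xs}. preari_pow n A xs / fact n)"
proof (cases "xs = []")
  case True
  thus ?thesis using assms by (simp add: expari_def)
next
  case False
  hence "{..length xs} = insert 0 (insert 1 {2..length xs})" by (cases xs) auto
  thus ?thesis by (simp add: expari_def preari_mone)
qed

text \<open>Recursion on the length: \<open>wfrec\<close> gives a fixed point and induction its
  uniqueness. Both \<open>logari\<close> and \<open>invgari\<close> are obtained this way.\<close>

lemma ex1_fixpoint_length:
  fixes F :: "('a list \<Rightarrow> 'b) \<Rightarrow> 'a list \<Rightarrow> 'b"
  assumes F: "\<And>A B xs. (\<And>ys. length ys < length xs \<Longrightarrow> A ys = B ys) \<Longrightarrow> F A xs = F B xs"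
  shows "\<exists>!A. F A = A"
proof (rule ex_ex1I)
  have "adm_wf (measure length) F"
    unfolding adm_wf_def by (intro allI impI F) simp
  from wfrec_fixpoint[OF wf_measure this] have "F (wfrec (measure length) F) = wfrec (measure length) F" by (rule sym)
  thus "\<exists>A. F A = A" by (rule exI[where x = "wfrec (measure length) F"])
next
  fix A B assume *: "F A = A" "F B = B"
  have "A xs = B xs" for xs
  proof (induction xs rule: length_induct)
    case (1 xs)
    have "F A xs = F B xs" by (rule F) (rule 1[rule_format])
    thus ?case by (simp only: *)
  qed
  thus "A = B" by blast
qed

lemma ex1_expari:
  assumes "S [] = 1"
  shows "\<exists>!A. A [] = 0 \<and> expari A = S"
proof -
  \<comment> \<open>The update \<open>A([] := 0)\<close> lets \<open>preari_pow_cong_strict\<close>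
    apply to every \<open>A\<close>, also before it is known to vanish on the empty word.\<close>
  define F where "F A = (\<lambda>xs. if xs = [] then 0 else
      S xs - (\<Sum>n\<in>{2..length xs}. preari_pow n (A([] := 0)) xs / fact n))" for A
  have "F A = A \<longleftrightarrow> A [] = 0 \<and> expari A = S" for A
  proof
    assume *: "F A = A"
    have 0: "A [] = 0" using fun_cong[OF *, of "[]"] by (simp add: F_def)
    hence 1: "A([] := 0) = A" by auto
    have "expari A xs = S xs" for xs
      using assms fun_cong[OF *, of xs] unfolding expari_eq[where A = A, OF 0]
      by (auto simp: F_def 0 1 mone_def)
    thus "A [] = 0 \<and> expari A = S" using 0 by auto
  next
    assume *: "A [] = 0 \<and> expari A = S"
    hence 1: "A([] := 0) = A" by auto
    have "F A xs = A xs" for xs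
      using * expari_eq[of A xs] by (auto simp: F_def 1 mone_def)
    thus "F A = A" by blast
  qed
  moreover have "\<exists>!A. F A = A"
  proof (rule ex1_fixpoint_length)
    fix A B :: mould and xs :: "real list"
    assume "\<And>ys. length ys < length xs \<Longrightarrow> A ys = B ys"
    thus "F A xs = F B xs"
      unfolding F_def
      by (auto intro!: sum.cong arg_cong[of _ _ "\<lambda>x. x / _"] preari_pow_cong_strict)
  qed
  ultimately show ?thesis by simp
qed

lemma
  assumes "S [] = 1"
  shows logari_Nil: "logari S [] = 0" and expari_logari: "expari (logari S) = S"
  using theI'[OF ex1_expari[of S]] assms unfolding logari_def by auto

section \<open>The inverse for \<open>gari\<close> by recursion on the length\<close>

lemma comps_length: "c \<in> set (comps xs) \<Longrightarrow> b \<in> set c \<Longrightarrow> length b \<le> length xs"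
proof (induction xs arbitrary: c b)
  case (Cons x xs)
  from Cons.prems(1) consider d where "d \<in> set (comps xs)" "c = [x] # d"
    | d where "d \<in> set (comps xs)" "d \<noteq> []" "c = (x # hd d) # tl d"
    by auto
  thus ?case
  proof cases
    case 1
    thus ?thesis using Cons.IH[OF 1(1)] Cons.prems(2) by force
  next
    case 2
    obtain e d' where d: "d = e # d'" using 2(2) by (cases d) auto
    have "length b' \<le> length xs" if "b' \<in> set d" for b' using Cons.IH[OF 2(1) that] .
    thus ?thesis using Cons.prems(2) 2(3) by (force simp: d)
  qed
qed auto

lemma invmu_cong:
  assumes "\<And>ys. length ys \<le> length xs \<Longrightarrow> T ys = T' ys"
  shows "invmu T xs = invmu T' xs"
proof -
  have "(\<Prod>b\<leftarrow>c. T b) = (\<Prod>b\<leftarrow>c. T' b)" if "c \<in> set (comps xs)" for c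
    using comps_length[OF that] by (intro arg_cong[of _ _ prod_list] map_cong refl assms) auto
  thus ?thesis unfolding invmu_def
    by (intro arg_cong[of _ _ sum_list] map_cong refl) auto
qed

lemma gdecs_length:
  assumes "ts \<in> gdecs xs" "(a, b, c) \<in> set ts"
  shows "length a < length xs" "length c < length xs"
proof -
  have "length (a @ b @ c) \<le> length (concat (map (\<lambda>(a, b, c). a @ b @ c) ts))"
    using assms(2) by (induction ts) auto
  moreover have "b \<noteq> []" using assms by (auto simp: gdecs_def)
  ultimately show "length a < length xs" "length c < length xs"
    using assms(1) by (auto simp: gdecs_def neq_Nil_conv)
qed

text \<open>\<open>T\<close> is evaluated on the pieces \<open>a\<close> and on blocks of the pieces
  \<open>c\<close>; all are shorter than \<open>xs\<close> because each \<open>b\<close> is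
  nonempty.\<close>

lemma garit_cong_strict:
  assumes "\<And>ys. length ys < length xs \<Longrightarrow> T ys = T' ys"
  shows "garit T S xs = garit T' S xs"
proof -
  have "(\<Prod>(a, b, c)\<leftarrow>ts. T a * invmu T c) = (\<Prod>(a, b, c)\<leftarrow>ts. T' a * invmu T' c)"
    if "ts \<in> gdecs xs" for ts
  proof (rule arg_cong[of _ _ prod_list], rule map_cong[OF refl], clarify)
    fix a b c assume "(a, b, c) \<in> set ts"
    from gdecs_length[OF that this] show "T a * invmu T c = T' a * invmu T' c"
      by (auto intro!: arg_cong2[of _ _ _ _ "(*)"] assms invmu_cong)
  qed
  thus ?thesis by (simp add: garit_def)
qed

lemma garit_Nil [simp]: "garit T S [] = 1"
  by (simp add: garit_def)

lemma gari_Nil [simp]: "gari S T [] = T []"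
  by (simp add: gari_def garit_def)

lemma gari_eq: "gari S T xs = T xs + (\<Sum>k\<in>{1..length xs}. garit T S (take k xs) * T (drop k xs))"
proof -
  have "{..length xs} = insert 0 {1..length xs}" by auto
  thus ?thesis by (simp add: gari_def mu_def garit_Nil)
qed

text \<open>By \<open>gari_eq\<close> the equation determines \<open>T xs\<close> from a sum over
  \<open>k \<ge> 1\<close>. There \<open>drop k xs\<close> is shorter than \<open>xs\<close>, and
  \<open>garit\<close> on a prefix uses \<open>T\<close> only on words shorter than that
  prefix.\<close>

lemma ex1_gari: "\<exists>!T. gari S T = mone"
proof -
  define F where "F T = (\<lambda>xs. mone xs -
      (\<Sum>k\<in>{1..length xs}. garit T S (take k xs) * T (drop k xs)))" for T
  have "F T = T \<longleftrightarrow> gari S T = mone" for T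
    by (auto simp: fun_eq_iff F_def gari_eq algebra_simps eq_diff_eq)
  moreover have "\<exists>!T. F T = T"
  proof (rule ex1_fixpoint_length)
    fix A B :: mould and xs :: "real list"
    assume "\<And>ys. length ys < length xs \<Longrightarrow> A ys = B ys"
    thus "F A xs = F B xs"
      unfolding F_def
      by (intro arg_cong[of _ _ "\<lambda>x. _ - x"] sum.cong refl
            arg_cong2[of _ _ _ _ "(*)"] garit_cong_strict) auto
  qed
  ultimately show ?thesis by simp
qed

lemma gari_invgari: "gari S (invgari S) = mone"
  unfolding invgari_def by (rule theI'[OF ex1_gari])

lemma invgari_Nil: "invgari S [] = 1"
  using fun_cong[OF gari_invgari[of S], of "[]"] by (simp add: mone_def)

section \<open>adari in lengths at most three\<close>

lemma gari_1: "T [] = 1 \<Longrightarrow> gari S T [x] = S [x] + T [x]"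
  by (simp add: gari_def mu_1 garit_1)

lemma gari_2: "T [] = 1 \<Longrightarrow> gari S T [x, y] =
    S [x, y] + S [x + y] * (T [x] - T [y]) + S [x] * T [y] + T [x, y]"
  by (simp add: gari_def mu_2 garit_1 garit_2)

lemma gari_3: "T [] = 1 \<Longrightarrow> gari S T [x, y, z] =
   S [x, y, z] + S [x + y, z] * (T [x] - T [y]) + S [x, y + z] * (T [y] - T [z])
   + S [x + y + z] * (T [x, y] - T [x] * T [z] + T [y] * T [z] - T [y, z])
   + (S [x, y] + S [x + y] * (T [x] - T [y])) * T [z] + S [x] * T [y, z] + T [x, y, z]"
  by (simp add: gari_def mu_3 garit_1 garit_2 garit_3)

lemma preari_1: "M [] = 0 \<Longrightarrow> N [] = 0 \<Longrightarrow> preari M N [x] = 0"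
  by (simp add: preari_def madd_def mu_1 arit_short)

lemma preari_2: "M [] = 0 \<Longrightarrow> N [] = 0 \<Longrightarrow> preari M N [x, y] =
    M [x + y] * (N [x] - N [y]) + M [x] * N [y]"
  by (simp add: preari_def madd_def mu_2 arit_2 algebra_simps)

lemma preari_3: "M [] = 0 \<Longrightarrow> N [] = 0 \<Longrightarrow> preari M N [x, y, z] =
    M [x + y, z] * (N [x] - N [y]) + M [x, y + z] * (N [y] - N [z])
    + M [x + y + z] * (N [x, y] - N [y, z]) + M [x] * N [y, z] + M [x, y] * N [z]"
  by (simp add: preari_def madd_def mu_3 arit_3 algebra_simps)

lemma expari_1: "A [] = 0 \<Longrightarrow> expari A [x] = A [x]"
  by (simp add: expari_eq mone_def)

lemma preari_pow_2: "preari_pow 2 A = preari A A"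
  by (simp add: numeral_2_eq_2 preari_mone)

lemma preari_pow_3: "preari_pow 3 A = preari (preari A A) A"
  by (simp add: numeral_3_eq_3 preari_mone)

lemma expari_2:
  assumes "A [] = 0"
  shows "expari A [x, y] = A [x, y] + preari A A [x, y] / 2"
proof -
  have "{2..length [x, y]} = {2}" by auto
  thus ?thesis
    unfolding expari_eq[where A = A, OF assms] by (simp add: mone_def preari_pow_2 preari_mone)
qed

lemma expari_3:
  assumes "A [] = 0"
  shows "expari A [x, y, z] =
    A [x, y, z] + preari A A [x, y, z] / 2 + preari (preari A A) A [x, y, z] / 6"
proof -
  have 23: "{2..length [x, y, z]} = {2, 3}" by auto
  have "fact 2 = (2::real)" "fact 3 = (6::real)" by (simp_all add: fact_numeral)
  thus ?thesis
    unfolding expari_eq[where A = A, OF assms] 23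
    by (simp add: mone_def preari_pow_2 preari_pow_3)
qed

section \<open>Inverses and the adjoint action in low lengths\<close>

lemma adari_Nil: "adari S A [] = 0"
  by (simp add: adari_def logari_Nil invgari_Nil)

text \<open>Applying \<open>expari\<close> removes the description operator in
  \<open>logari\<close>; the resulting equation is then solved length by length.\<close>

lemma expari_adari: "expari (adari S A) = gari (gari S (expari A)) (invgari S)"
  by (simp add: adari_def expari_logari invgari_Nil)

lemma invgari_1: "invgari S [x] = - S [x]"
  using fun_cong[OF gari_invgari[of S], of "[x]"] by (simp add: gari_1 invgari_Nil mone_def)

lemma invgari_2: "invgari S [x, y] = - S [x, y] + S [x + y] * (S [x] - S [y]) + S [x] * S [y]"
  using fun_cong[OF gari_invgari[of S], of "[x, y]"]
  by (simp add: gari_2 invgari_Nil invgari_1 mone_def algebra_simps)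

lemma invgari_3: "invgari S [x, y, z] =
   - S [x, y, z] + S [x + y, z] * (S [x] - S [y]) + S [x, y + z] * (S [y] - S [z])
   - S [x + y + z] * (invgari S [x, y] - S [x] * S [z] + S [y] * S [z] - invgari S [y, z])
   + (S [x, y] - S [x + y] * (S [x] - S [y])) * S [z] - S [x] * invgari S [y, z]"
  using fun_cong[OF gari_invgari[of S], of "[x, y, z]"]
  by (simp add: gari_3 invgari_Nil invgari_1 mone_def algebra_simps)

lemma expari_Nil: "expari A [] = 1"
  by (simp add: expari_def mone_def)

lemma adari_1: "A [] = 0 \<Longrightarrow> adari S A [x] = A [x]"
  using fun_cong[OF expari_adari[of S A], of "[x]"]
  by (simp add: expari_1 gari_1 invgari_1 invgari_Nil adari_Nil expari_Nil)

text \<open>The correction to \<open>A [x, y]\<close> is the bracket of the length-one parts of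
  \<open>S\<close> and \<open>A\<close>.\<close>

lemma adari_2: "A [] = 0 \<Longrightarrow> adari S A [x, y] = A [x, y]
    + S [x + y] * (A [x] - A [y]) + S [x] * A [y] - A [x + y] * (S [x] - S [y]) - A [x] * S [y]"
  using fun_cong[OF expari_adari[of S A], of "[x, y]"]
  by (simp add: expari_2 expari_1 preari_2 adari_1 gari_1 gari_2 invgari_1 invgari_2 invgari_Nil
    adari_Nil expari_Nil algebra_simps)

lemma ari_Nil: "ari M N [] = 0"
  by (simp add: ari_def msub_def preari_Nil)

lemma ari_1: "M [] = 0 \<Longrightarrow> N [] = 0 \<Longrightarrow> ari M N [x] = 0"
  by (simp add: ari_def msub_def preari_1)

lemma ari_2: "M [] = 0 \<Longrightarrow> N [] = 0 \<Longrightarrow> ari M N [x, y] =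
    M [x + y] * (N [x] - N [y]) - N [x + y] * (M [x] - M [y]) + M [x] * N [y] - N [x] * M [y]"
  by (simp add: ari_def msub_def preari_2)

lemma ari_3: "M [] = 0 \<Longrightarrow> N [] = 0 \<Longrightarrow> ari M N [x, y, z] =
    M [x + y, z] * (N [x] - N [y]) + M [x, y + z] * (N [y] - N [z])
    + M [x + y + z] * (N [x, y] - N [y, z]) + M [x] * N [y, z] + M [x, y] * N [z]
    - (N [x + y, z] * (M [x] - M [y]) + N [x, y + z] * (M [y] - M [z])
    + N [x + y + z] * (M [x, y] - M [y, z]) + N [x] * M [y, z] + N [x, y] * M [z])"
  by (simp add: ari_def msub_def preari_3)


text \<open>For \<open>S\<close> in GARI and \<open>L = adari S A\<close> this is the part linear in
  \<open>A\<close> of \<open>gari S (expari A) = gari (expari L) S\<close>, solved for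
  \<open>L [x, y, z]\<close>. The terms of higher degree in \<open>A\<close> cancel upon
  expansion.\<close>

lemma adari_3:
  assumes A: "\<And>xs. length xs \<noteq> 1 \<Longrightarrow> A xs = 0"
  shows "adari S A [x, y, z] = S [x + y, z] * (A [x] - A [y]) + S [x, y + z] * (A [y] - A [z])
    + S [x, y] * A [z]
    - adari S A [x + y, z] * (S [x] - S [y]) - adari S A [x, y + z] * (S [y] - S [z])
    - A [x + y + z] * (S [x, y] - S [x] * S [z] + S [y] * S [z] - S [y, z])
    - (adari S A [x, y] + A [x + y] * (S [x] - S [y])) * S [z] - A [x] * S [y, z]"
proof -
  have A': "A [] = 0" "\<And>x y. A [x, y] = 0" "\<And>x y z. A [x, y, z] = 0" by (simp_all add: A)
  let ?L = "adari S A"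
  have "gari (gari S (expari A)) (invgari S) [x, y, z] = expari ?L [x, y, z]"
    by (simp only: expari_adari)
  also have "\<dots> = ?L [x, y, z] + preari ?L ?L [x, y, z] / 2 + preari (preari ?L ?L) ?L [x, y, z] / 6"
    by (rule expari_3) (rule adari_Nil)
  \<comment> \<open>The two \<open>preari\<close> terms involve \<open>?L\<close> in lengths one and
    two only, where it is already known.\<close>
  finally have "?L [x, y, z] = gari (gari S (expari A)) (invgari S) [x, y, z]
      - preari ?L ?L [x, y, z] / 2 - preari (preari ?L ?L) ?L [x, y, z] / 6"
    by linarith
  thus ?thesis
    by (simp add: expari_3 expari_2 expari_1 preari_1 preari_2 preari_3 preari_Nil adari_1 adari_2
          gari_1 gari_2 gari_3 invgari_1 invgari_2 invgari_3 invgari_Nil adari_Nil expari_Nil A' add.assoc)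
       (simp add: field_simps)
qed

text \<open>Conjugation by the exponential of \<open>-P\<close> is the exponential of bracketing
  with \<open>-P\<close>, and \<open>ari A P\<close> is the bracket of \<open>-P\<close> with
  \<open>A\<close>. A third bracket would start in length four. In length two, agreement of
  \<open>S\<close> with the exponential is asked only at the four words that occur, since
  \<open>pal\<close> satisfies it only away from poles.\<close>

lemma adari_3_expari:
  assumes A: "\<And>xs. length xs \<noteq> 1 \<Longrightarrow> A xs = 0" and P: "P [] = 0"
    and S1: "\<And>u. S [u] = - P [u]"
    and S2: "\<And>w. w \<in> {[x, y], [y, z], [x + y, z], [x, y + z]} \<Longrightarrow> S w = expari (mscale (-1) P) w"
  shows "adari S A [x, y, z] = ari A P [x, y, z] + ari (ari A P) P [x, y, z] / 2"
proof -
  have A': "A [] = 0" "\<And>x y. A [x, y] = 0" "\<And>x y z. A [x, y, z] = 0" by (simp_all add: A)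
  have S2: "S [u, v] = - P [u, v] + (P [u + v] * (P [u] - P [v]) + P [u] * P [v]) / 2"
    if "[u, v] \<in> {[x, y], [y, z], [x + y, z], [x, y + z]}" for u v
    using S2[OF that] P by (simp add: expari_2 preari_2 mscale_def algebra_simps)
  have S2': "S [x, y] = - P [x, y] + (P [x + y] * (P [x] - P [y]) + P [x] * P [y]) / 2"
     "S [y, z] = - P [y, z] + (P [y + z] * (P [y] - P [z]) + P [y] * P [z]) / 2"
     "S [x + y, z] = - P [x + y, z] + (P [x + y + z] * (P [x + y] - P [z]) + P [x + y] * P [z]) / 2"
     "S [x, y + z] = - P [x, y + z] + (P [x + y + z] * (P [x] - P [y + z]) + P [x] * P [y + z]) / 2"
    by (simp_all add: S2 add.assoc)
  show ?thesis
    by (simp add: adari_3[OF A] adari_2 A' P ari_3 ari_2 ari_1 ari_Nil S1 S2' add.assoc)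
       (simp add: field_simps)
qed

section \<open>The moulds pal, sang and slang\<close>

lemma bern_1: "bern 1 = - 1 / 2" and bern_2: "bern 2 = 1 / 6"
proof -
  define E :: "real fps" where "E = fps_exp 1 - 1"
  have E: "fps_nth E n = (if n = 0 then 0 else 1 / fact n)" for n
    by (simp add: E_def)
  \<comment> \<open>\<open>E\<close> has no constant term; the division of \<open>fps_X\<close> by
    it is exact because its subdegree is one. The values then come from the coefficients of degree
    one to three in \<open>F * E = fps_X\<close>.\<close>
  have "subdegree E = 1" by (intro subdegreeI) (auto simp: E)
  hence "E dvd fps_X" by (subst fps_dvd_iff) auto
  hence "fps_X / E * E = fps_X" by simp
  define F where "F = fps_X / E"
  have *: "fps_nth (F * E) n = fps_nth fps_X n" for n
    unfolding F_def \<open>fps_X / E * E = fps_X\<close> ..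
  have "fps_nth F 0 = 1" using *[of 1] by (simp add: fps_mult_nth E)
  moreover from this have F1: "fps_nth F 1 = - 1 / 2"
    using *[of 2] by (simp add: fps_mult_nth E numeral_2_eq_2)
  ultimately have "fps_nth F 2 = 1 / 12"
    using *[of 3] by (simp add: fps_mult_nth E numeral_eq_Suc)
  thus "bern 1 = - 1 / 2" "bern 2 = 1 / 6"
    using F1 by (simp_all add: bern_def F_def E_def)
qed

declare pal.simps [simp del]

lemma pal_Nil: "pal [] = 1"
  by (subst pal.simps) simp

text \<open>The factor \<open>(1 / u) * u\<close> is not cancelled, because it is 0 at
  \<open>u = 0\<close>; likewise in \<open>pal_2\<close>.\<close>

lemma dupal_1: "dupal [u] = - (1 / u) * u / 2"
  by (simp add: dupal_def bern_1[unfolded One_nat_def])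

lemma dupal_2: "dupal [u, v] = (u - v) / (12 * u * v)"
  by (simp add: dupal_def lessThan_Suc bern_2[unfolded numeral_2_eq_2])

lemma pal_1: "pal [u] = - (1 / (2 * u))"
  by (subst pal.simps) (simp add: pal_Nil dupal_1)

lemma pal_2:
  "pal [u, v] = ((u - v) / (12 * u * v) + (1 / (2 * u)) * (1 / v) * v / 2) / (u + v)"
  by (subst pal.simps) (simp add: pal_Nil pal_1 dupal_1 dupal_2 lessThan_Suc)

lemma sprime_Nil: "sprime [] = 0"
  by (simp add: sprime_def)

lemma sprime_1: "sprime [u] = 1 / (2 * u)"
  by (simp add: sprime_def)

text \<open>Here \<open>x1 - x2 = - v\<close>, whence the minus sign.\<close>

lemma sprime_2: "sprime [u, v] = (1 / (u * (u + v)) - 1 / ((u + v) * v)) / 12"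
  by (simp add: sprime_def Let_def)

text \<open>The hypotheses exclude the poles, where the value of division by zero would spoil the
  identity. The quadratic part of the exponential is insensitive to the sign change of
  \<open>sprime\<close>.\<close>

lemma pal_2_eq_expari:
  assumes "u \<noteq> 0" "v \<noteq> 0" "u + v \<noteq> 0"
  shows "pal [u, v] = expari (mscale (- 1) sprime) [u, v]"
proof -
  have "expari (mscale (- 1) sprime) [u, v] = - sprime [u, v]
      + (sprime [u + v] * (sprime [u] - sprime [v]) + sprime [u] * sprime [v]) / 2"
    by (simp add: expari_2 preari_2 mscale_def sprime_Nil algebra_simps)
  also have "\<dots> = pal [u, v]"
    using assms unfolding pal_2 sprime_1 sprime_2
    by (simp add: divide_simps) (simp add: algebra_simps)
  finally show ?thesis ..
qed

section \<open>The moulds \<open>paj\<close>, \<open>sang\<close> and \<open>slang\<close>\<close>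

lemma paj_Nil: "paj [] = 1"
  by (simp add: paj_def)

lemma paj_1: "paj [x] = 1 / x"
  by (simp add: paj_def)

lemma sang_Nil: "A [] = 0 \<Longrightarrow> sang A [] = 0"
  by (simp add: sang_def Let_def mscale_def madd_def neg_def adari_Nil)

text \<open>Conjugation by \<open>paj\<close> and \<open>adari paj\<close> are trivial in length
  one, so \<open>sang\<close> takes the even part.\<close>

lemma sang_1: "A [] = 0 \<Longrightarrow> sang A [x] = (A [x] + A [- x]) / 2"
  by (simp add: sang_def Let_def mscale_def madd_def neg_def adari_1 mu_1 paj_Nil)

text \<open>Let \<open>X\<close> be the conjugate of \<open>A\<close> by \<open>paj\<close>. In
  length two \<open>X\<close> and \<open>adari paj X\<close> consist of products of two odd
  functions, so \<open>neg\<close> changes nothing. The bracket inside \<open>adari paj X\<close>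
  cancels one of the two copies of \<open>A [x] / y - A [y] / x\<close>.\<close>

lemma sang_2_odd:
  assumes "\<And>xs. length xs \<noteq> 1 \<Longrightarrow> A xs = 0" and odd: "\<And>u. A [- u] = - A [u]"
  shows "sang A [x, y] = (A [x] / y - A [y] / x + (A [x] - A [y]) / (x + y)
           - A [x + y] * (1 / x - 1 / y)) / 2"
proof -
  have A: "A [] = 0" "A [u, v] = 0" for u v by (simp_all add: assms(1))
  have "A [- x - y] = - A [x + y]" using odd[of "x + y"] by simp
  moreover have "1 / (- x - y) = - (1 / (x + y))"
    by (metis divide_minus_right minus_add_distrib uminus_add_conv_diff add.commute)
  ultimately show ?thesis
    by (simp add: sang_def Let_def mscale_def madd_def neg_def adari_2 mu_1 mu_2 paj_Nil paj_1 A odd)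
       (simp add: algebra_simps diff_divide_distrib)
qed

text \<open>In length one \<open>sang\<close> returns the even part, here \<open>A\<close> itself,
  and \<open>adari\<close> changes nothing there.\<close>

lemma slang_1_even:
  assumes "\<And>xs. length xs \<noteq> 1 \<Longrightarrow> A xs = 0" and "\<And>u. A [- u] = A [u]"
  shows "slang 1 A = adari pal A"
proof -
  have "leng 1 (adari (invgari pal) (sang A)) xs = A xs" for xs
  proof (cases "length xs = 1")
    case True
    then obtain x where "xs = [x]" by (cases xs) auto
    thus ?thesis using assms by (simp add: leng_def adari_1 sang_Nil sang_1)
  qed (simp add: leng_def assms)
  hence "leng 1 (adari (invgari pal) (sang A)) = A" by blast
  thus ?thesis by (simp add: slang_def)
qed

lemma slang_Nil: "slang r A [] = 0"
  by (simp add: slang_def adari_Nil)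

lemma slang_2_short: "slang 2 A [x] = 0"
  by (simp add: slang_def adari_1 leng_def)

lemma slang_2_odd:
  assumes "A [] = 0" and "\<And>u. A [- u] = - A [u]"
  shows "slang 2 A [x, y] = sang A [x, y]"
proof -
  have "sang A [u] = 0" for u using assms by (simp add: sang_1)
  thus ?thesis using assms(1) by (simp add: slang_def adari_2 leng_def sang_Nil)
qed

section \<open>Power moulds and generic points in length three\<close>

lemma sa_eq_0: "length xs \<noteq> 1 \<Longrightarrow> sa s xs = 0"
  by (simp add: sa_def)

lemma sa_odd_index: "sa (2 * int n + 1) [u] = u ^ (2 * n)"
  by (simp add: sa_def power_int_def nat_mult_distrib)

lemma sa_even_index:
  assumes "n \<ge> 1"
  shows "sa (2 * int n) [u] = u ^ (2 * n - 1)"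
  using assms by (simp add: sa_def power_int_def nat_diff_distrib' nat_mult_distrib)

lemma sa_minus_1: "sa (- 1) [u] = 1 / u ^ 2"
  by (simp add: sa_def power_int_def field_simps)

lemma slang_1_sa: "slang 1 (sa (2 * int n + 1)) = adari pal (sa (2 * int n + 1))"
  by (rule slang_1_even) (simp_all add: sa_eq_0 sa_odd_index)

lemma length_3_cases:
  assumes "length xs = 3"
  obtains x y z where "xs = [x, y, z]"
  using assms by (auto simp: numeral_3_eq_3 length_Suc_conv)

text \<open>The six linear forms are the sums of consecutive letters, which include every
  denominator met in length three; none vanishes at \<open>[1, 1, 1]\<close>.\<close>

lemma gen_eq_3I:
  assumes "\<And>x y z. x \<noteq> 0 \<Longrightarrow> y \<noteq> 0 \<Longrightarrow> z \<noteq> 0 \<Longrightarrow> x + y \<noteq> 0 \<Longrightarrow> y + z \<noteq> 0 \<Longrightarrow> x + y + z \<noteq> 0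
    \<Longrightarrow> f [x, y, z] = g [x, y, z]"
  shows "gen_eq 3 f g"
proof (rule gen_eqI)
  let ?p = "\<lambda>xs :: real list. xs ! 0 * xs ! 1 * xs ! 2 * (xs ! 0 + xs ! 1) * (xs ! 1 + xs ! 2)
    * (xs ! 0 + xs ! 1 + xs ! 2)"
  show "qpoly 3 ?p" by (intro qpoly_intros) auto
  show "length [1, 1, 1 :: real] = 3" "?p [1, 1, 1] \<noteq> 0" by auto
  fix xs :: "real list" assume "length xs = 3" and p: "?p xs \<noteq> 0"
  then obtain x y z where xs: "xs = [x, y, z]" by (auto elim: length_3_cases)
  show "f xs = g xs" unfolding xs by (rule assms) (use p in \<open>auto simp: xs\<close>)
qed

lemma xi_eq_slang_1: "cong_ari 4 (xi n) (slang 1 (sa (2 * int n + 1)))"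
proof -
  define A where "A = sa (2 * int n + 1)"
  have A: "A [] = 0" "A [x, y] = 0" "A [x, y, z] = 0" for x y z
    by (simp_all add: A_def sa_eq_0)
  have xi: "xi n = (\<lambda>xs. A xs + ari A sprime xs + ari (ari A sprime) sprime xs / 2)"
    by (simp add: A_def xi_def xiprime_def madd_def mscale_def)
  have pal: "pal [u] = - sprime [u]" for u by (simp add: pal_1 sprime_1)
  \<comment> \<open>Below length three only length-one values of \<open>pal\<close> enter, and these
    equal \<open>- sprime [u]\<close> for every \<open>u\<close>, the pole included.\<close>
  have "gen_eq m (xi n) (adari pal A)" if m: "m < 3" for m
  proof (rule gen_eq_pointwise)
    fix xs :: "real list" assume "length xs = m"
    with m consider "xs = []" | x where "xs = [x]" | x y where "xs = [x, y]"
      by (cases xs; cases "tl xs"; cases "tl (tl xs)") auto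
    thus "xi n xs = adari pal A xs"
      by cases (simp_all add: xi A ari_Nil ari_1 ari_2 adari_Nil adari_1 adari_2 sprime_Nil pal algebra_simps)
  qed
  \<comment> \<open>Length-two values of \<open>pal\<close> enter now, and they match the
    exponential only generically.\<close>
  moreover have "gen_eq 3 (xi n) (adari pal A)"
  proof (rule gen_eq_3I)
    fix x y z :: real
    assume "x \<noteq> 0" "y \<noteq> 0" "z \<noteq> 0" "x + y \<noteq> 0" "y + z \<noteq> 0" "x + y + z \<noteq> 0"
    hence "adari pal A [x, y, z] = ari A sprime [x, y, z] + ari (ari A sprime) sprime [x, y, z] / 2"
      by (intro adari_3_expari) (auto simp: A_def sa_eq_0 sprime_Nil pal add.assoc intro!: pal_2_eq_expari)
    thus "xi n [x, y, z] = adari pal A [x, y, z]" by (simp add: xi A)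
  qed
  ultimately have "gen_eq m (xi n) (adari pal A)" if "m < 4" for m
    using that by (cases "m = 3") auto
  thus ?thesis unfolding cong_ari_def slang_1_sa A_def by blast
qed

section \<open>Polynomiality of D\<close>

primrec taylor1 :: "nat \<Rightarrow> 'a :: comm_ring_1 \<Rightarrow> 'a \<Rightarrow> 'a" where
  "taylor1 0 h y = 0"
| "taylor1 (Suc k) h y = (y + h) * taylor1 k h y + y ^ k"

text \<open>The second-order Taylor remainder of a power, divided by \<open>h ^ 2\<close>. As in
  \<open>taylor1\<close>, the recursion avoids division, so polynomiality follows by induction on
  \<open>k\<close>.\<close>

primrec taylor2 :: "nat \<Rightarrow> 'a :: comm_ring_1 \<Rightarrow> 'a \<Rightarrow> 'a" where
  "taylor2 0 h y = 0"
| "taylor2 (Suc k) h y = (y + h) * taylor2 k h y + of_nat k * y ^ (k - 1)"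

lemma taylor1: "(y + h) ^ k = y ^ k + h * taylor1 k h y"
  by (induction k) (simp_all add: algebra_simps)

lemma taylor2: "(y + h) ^ k = y ^ k + of_nat k * h * y ^ (k - 1) + h ^ 2 * taylor2 k h y"
proof (induction k)
  case (Suc k)
  have "(y + h) ^ Suc k = (y + h) * (y ^ k + of_nat k * h * y ^ (k - 1) + h ^ 2 * taylor2 k h y)"
    by (simp only: power_Suc Suc)
  \<comment> \<open>The split handles the truncated exponent \<open>k - 1\<close>, whose coefficient
    is 0 at \<open>k = 0\<close>.\<close>
  thus ?case by (cases k) (simp_all add: algebra_simps power2_eq_square)
qed simp

text \<open>The error of the trapezoidal rule for \<open>\<integral> 2b t^(2b-1) dt\<close> over \<open>[y, y + h]\<close>, divided by \<open>h^2\<close>.\<close>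
definition trapez :: "nat \<Rightarrow> 'a :: comm_ring_1 \<Rightarrow> 'a \<Rightarrow> 'a" where
  "trapez b h y = taylor2 (2 * b) h y - of_nat b * taylor1 (2 * b - 1) h y"

text \<open>The terms linear in \<open>h\<close> cancel: \<open>2 * b\<close> from the Taylor
  expansion against \<open>b\<close> from each endpoint.\<close>

lemma trapez: "h ^ 2 * trapez b h y =
    (y + h) ^ (2 * b) - y ^ (2 * b) - of_nat b * h * (y ^ (2 * b - 1) + (y + h) ^ (2 * b - 1))"
  unfolding trapez_def taylor2[of y h "2 * b"] taylor1[of y h "2 * b - 1"]
  by (simp add: algebra_simps power2_eq_square)

lemma trapez_divide:
  fixes h y :: real
  assumes "h \<noteq> 0"
  shows "trapez b h y = ((y + h) ^ (2 * b) - y ^ (2 * b)) / h ^ 2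
    - b * (y ^ (2 * b - 1) + (y + h) ^ (2 * b - 1)) / h"
proof -
  have "trapez b h y = h ^ 2 * trapez b h y / h ^ 2" using assms by simp
  thus ?thesis
    unfolding trapez using assms by (simp add: diff_divide_distrib power2_eq_square)
qed

lemma qpoly_taylor1: "qpoly m p \<Longrightarrow> qpoly m q \<Longrightarrow> qpoly m (\<lambda>xs. taylor1 k (p xs) (q xs))"
  using qpoly_of_nat[of m 0] by (induction k) (simp_all add: qpoly_intros)

lemma qpoly_taylor2: "qpoly m p \<Longrightarrow> qpoly m q \<Longrightarrow> qpoly m (\<lambda>xs. taylor2 k (p xs) (q xs))"
  using qpoly_of_nat[of m 0] by (induction k) (simp_all add: qpoly_intros)

lemma qpoly_trapez: "qpoly m p \<Longrightarrow> qpoly m q \<Longrightarrow> qpoly m (\<lambda>xs. trapez b (p xs) (q xs))"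
  unfolding trapez_def by (intro qpoly_intros qpoly_taylor1 qpoly_taylor2)

text \<open>The three terms absorb the apparent poles along \<open>x = 0\<close>,
  \<open>y = 0\<close> and \<open>x + y = 0\<close>, each being a trapezoidal error with that form
  as step.\<close>

definition depth2_poly :: "nat \<Rightarrow> 'a :: comm_ring_1 \<Rightarrow> 'a \<Rightarrow> 'a" where
  "depth2_poly b x y = trapez b x y - trapez b y x - trapez b (x + y) (- y)"

lemma qpoly_depth2_poly:
  "qpoly m p \<Longrightarrow> qpoly m q \<Longrightarrow> qpoly m (\<lambda>xs. depth2_poly b (p xs) (q xs))"
  unfolding depth2_poly_def by (intro qpoly_intros qpoly_trapez)

text \<open>Grouped by linear form, \<open>ari\<close> supplies the double poles and
  \<open>slang\<close> the simple ones; each group is one instance of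
  \<open>trapez_divide\<close>.\<close>

lemma depth2_eq_poly:
  assumes "b \<ge> 1" "x \<noteq> 0" "y \<noteq> 0" "x + y \<noteq> 0"
  shows "ari (sa (2 * int b + 1)) (sa (- 1)) [x, y] + 2 * real b * slang 2 (sa (2 * int b)) [x, y]
    = depth2_poly b x y"
proof -
  have odd: "odd (2 * b - 1)" using assms(1) by simp
  let ?B = "sa (2 * int b)"
  have B: "?B [u] = u ^ (2 * b - 1)" for u by (rule sa_even_index[OF assms(1)])
  have B': "?B [- u] = - ?B [u]" for u using odd by (simp add: B)
  have "slang 2 ?B [x, y] = sang ?B [x, y]"
    by (rule slang_2_odd) (simp_all add: sa_eq_0 B')
  also have "\<dots> = (x ^ (2 * b - 1) / y - y ^ (2 * b - 1) / x
      + (x ^ (2 * b - 1) - y ^ (2 * b - 1)) / (x + y)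
      - (x + y) ^ (2 * b - 1) * (1 / x - 1 / y)) / 2"
    unfolding B[symmetric] by (rule sang_2_odd) (simp_all add: sa_eq_0 B')
  finally have slang: "2 * real b * slang 2 ?B [x, y] = real b * (x ^ (2 * b - 1) / y - y ^ (2 * b - 1) / x
      + (x ^ (2 * b - 1) - y ^ (2 * b - 1)) / (x + y)
      - (x + y) ^ (2 * b - 1) * (1 / x - 1 / y))"
    by simp
  have ari: "ari (sa (2 * int b + 1)) (sa (- 1)) [x, y] =
      (x + y) ^ (2 * b) * (1 / x ^ 2 - 1 / y ^ 2) - (x ^ (2 * b) - y ^ (2 * b)) / (x + y) ^ 2
      + x ^ (2 * b) / y ^ 2 - y ^ (2 * b) / x ^ 2"
    by (simp add: ari_2 sa_eq_0 sa_odd_index sa_minus_1)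
  show ?thesis
    unfolding slang ari depth2_poly_def
      trapez_divide[OF assms(2)] trapez_divide[OF assms(3)] trapez_divide[OF assms(4)]
    \<comment> \<open>Oddness turns \<open>(- y) ^ (2 * b - 1)\<close> into
      \<open>- (y ^ (2 * b - 1))\<close> in the term with base point \<open>- y\<close>.\<close>
    using odd by (simp add: algebra_simps diff_divide_distrib add_divide_distrib)
qed

section \<open>The mould D in length three\<close>

lemma Dab_short:
  assumes "length xs < 3"
  shows "Dab a b xs = 0"
proof -
  from assms consider "xs = []" | x where "xs = [x]" | x y where "xs = [x, y]"
    by (cases xs; cases "tl xs"; cases "tl (tl xs)") auto
  thus ?thesis
    \<comment> \<open>The second arguments of the two outer brackets start in length two, so these
      brackets start in length three.\<close>
    by cases (simp_all add: Dab_def madd_def mscale_def ari_Nil ari_1 ari_2 sa_eq_0 slang_Nil slang_2_short)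
qed

lemma Dab_3:
  fixes a b :: nat
  assumes "b \<ge> 1"
    and "x \<noteq> 0" "y \<noteq> 0" "z \<noteq> 0" "x + y \<noteq> 0" "y + z \<noteq> 0" "x + y + z \<noteq> 0"
  defines "N \<equiv> 2 * a"
  shows "Dab a b [x, y, z] =
      (x + y + z) ^ N * (depth2_poly b x y - depth2_poly b y z)
      + x ^ N * depth2_poly b y z - z ^ N * depth2_poly b x y
      - (x ^ N - y ^ N) * depth2_poly b (x + y) z - (y ^ N - z ^ N) * depth2_poly b x (y + z)"
proof -
  have S: "slang 1 (sa (2 * int a + 1)) [u] = u ^ N" for u
    unfolding slang_1_sa by (simp add: adari_1 sa_eq_0 sa_odd_index N_def)
  have E: "depth2_poly b x y = ari (sa (2 * int b + 1)) (sa (- 1)) [x, y] + 2 * real b * slang 2 (sa (2 * int b)) [x, y]"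
     "depth2_poly b y z = ari (sa (2 * int b + 1)) (sa (- 1)) [y, z] + 2 * real b * slang 2 (sa (2 * int b)) [y, z]"
     "depth2_poly b (x + y) z = ari (sa (2 * int b + 1)) (sa (- 1)) [x + y, z] + 2 * real b * slang 2 (sa (2 * int b)) [x + y, z]"
     "depth2_poly b x (y + z) = ari (sa (2 * int b + 1)) (sa (- 1)) [x, y + z] + 2 * real b * slang 2 (sa (2 * int b)) [x, y + z]"
    using assms by (simp_all add: depth2_eq_poly add.assoc)
  \<comment> \<open>Since \<open>N'\<close> starts in length two, only the length-one part of
    \<open>M\<close> enters. It is the same for \<open>sa\<close> and its \<open>slang 1\<close>, so
    the two brackets have the same shape and add up linearly.\<close>
  have ari: "ari M N' [x, y, z] =
      (x + y + z) ^ N * (N' [x, y] - N' [y, z]) + x ^ N * N' [y, z] - z ^ N * N' [x, y]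
      - (x ^ N - y ^ N) * N' [x + y, z] - (y ^ N - z ^ N) * N' [x, y + z]"
    if "M [] = 0" "\<And>u. M [u] = u ^ N" "N' [] = 0" "\<And>u. N' [u] = 0" for M N'
    using that by (simp add: ari_3 algebra_simps)
  let ?C = "ari (sa (2 * int b + 1)) (sa (- 1))" and ?D = "slang 2 (sa (2 * int b))"
  have "ari (sa (2 * int a + 1)) ?C [x, y, z] =
      (x + y + z) ^ N * (?C [x, y] - ?C [y, z]) + x ^ N * ?C [y, z] - z ^ N * ?C [x, y]
      - (x ^ N - y ^ N) * ?C [x + y, z] - (y ^ N - z ^ N) * ?C [x, y + z]"
    by (rule ari) (simp_all add: sa_eq_0 sa_odd_index N_def ari_Nil ari_1)
  moreover have "ari (slang 1 (sa (2 * int a + 1))) ?D [x, y, z] =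
      (x + y + z) ^ N * (?D [x, y] - ?D [y, z]) + x ^ N * ?D [y, z] - z ^ N * ?D [x, y]
      - (x ^ N - y ^ N) * ?D [x + y, z] - (y ^ N - z ^ N) * ?D [x, y + z]"
    by (rule ari) (rule slang_Nil S slang_2_short)+
  ultimately show ?thesis
    unfolding E Dab_def madd_def mscale_def by (simp only:) (simp only: algebra_simps)
qed

lemma Dab_qpoly:
  assumes "b \<ge> 1"
  shows "comp_is_qpoly 3 (Dab a b)"
proof -
  let ?E = "depth2_poly b :: real \<Rightarrow> real \<Rightarrow> real"
  let ?p = "\<lambda>xs :: real list. let x = xs ! 0; y = xs ! 1; z = xs ! 2 in
      (x + y + z) ^ (2 * a) * (?E x y - ?E y z)
      + x ^ (2 * a) * ?E y z - z ^ (2 * a) * ?E x y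
      - (x ^ (2 * a) - y ^ (2 * a)) * ?E (x + y) z - (y ^ (2 * a) - z ^ (2 * a)) * ?E x (y + z)"
  have "qpoly 3 ?p"
    unfolding Let_def by (intro qpoly_intros qpoly_depth2_poly) auto
  moreover have "gen_eq 3 (Dab a b) ?p"
    by (rule gen_eq_3I) (simp add: Dab_3[OF assms])
  ultimately show ?thesis unfolding comp_is_qpoly_def by blast
qed

section \<open>Combining the congruences\<close>

lemma coefficient_split:
  fixes d :: real
  assumes "d \<noteq> 0"
  shows "p / (24 * d * q) * k * (x + 2 * d * y) = 1 / (24 * d) * (p / q) * k * x + 1 / 12 * (p / q) * k * y"
proof -
  \<comment> \<open>With \<open>p / q\<close> kept as one symbol only \<open>d\<close> has to be
    cancelled; the factor \<open>2 * d\<close> turns \<open>1 / (24 * d)\<close> into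
    \<open>1 / 12\<close>.\<close>
  have "p / (24 * d * q) = (p / q) / (24 * d)" by (simp add: mult.commute)
  moreover have "r / (24 * d) * k * (x + 2 * d * y) = 1 / (24 * d) * r * k * x + 1 / 12 * r * k * y" for r
    using assms by (simp add: field_simps)
  ultimately show ?thesis by presburger
qed

text \<open>\<open>sigc\<close> and \<open>luma\<close> stand for any representatives of the two
  classes, and \<open>b\<close> is \<open>n - a\<close>. Both are compared with \<open>xi n\<close>,
  so that the leading term drops out of their difference.\<close>

theorem theorem3p1:
  fixes n :: nat and sigc luma :: mould
  assumes n: "n \<ge> 1"
    and sigc: "cong_ari 4 sigc
      (madd (xi n) (msum {1..<n} (\<lambda>a. mscale
          (1 / (24 * real (n - a)) * (bern (2*a) * bern (2*(n - a)) / bern (2*n))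
             * of_nat ((2*n) choose (2*a)))
          (ari (sa (2 * int a + 1)) (ari (sa (2 * int (n - a) + 1)) (sa (-1)))))))"
    and luma: "cong_ari 4 luma
      (msub (slang 1 (sa (2 * int n + 1))) (msum {1..<n} (\<lambda>a. mscale
          (1 / 12 * (bern (2*a) * bern (2*(n - a)) / bern (2*n)) * of_nat ((2*n) choose (2*a)))
          (ari (slang 1 (sa (2 * int a + 1))) (slang 2 (sa (2 * int (n - a))))))))"
  shows "cong_ari 4 (xi n) (slang 1 (sa (2 * int n + 1)))
    \<and> cong_ari 4 (msub sigc luma)
        (msum {1..<n} (\<lambda>a. mscale
           (bern (2*a) * bern (2*(n - a)) / (24 * real (n - a) * bern (2*n))
              * of_nat ((2*n) choose (2*a)))
           (Dab a (n - a))))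
    \<and> (\<forall>a\<in>{1..<n}. in_ari_ge 3 (Dab a (n - a)))
    \<and> (\<forall>a\<in>{1..<n}. comp_is_qpoly 3 (Dab a (n - a)))"
proof (intro conjI ballI)
  show xi: "cong_ari 4 (xi n) (slang 1 (sa (2 * int n + 1)))" by (rule xi_eq_slang_1)
  show "cong_ari 4 (msub sigc luma)
        (msum {1..<n} (\<lambda>a. mscale
           (bern (2*a) * bern (2*(n - a)) / (24 * real (n - a) * bern (2*n))
              * of_nat ((2*n) choose (2*a)))
           (Dab a (n - a))))" (is "cong_ari 4 _ ?D")
    unfolding cong_ari_def
  proof (intro allI impI)
    fix m :: nat assume m: "m < 4"
    have gen: "gen_eq m M N" if "cong_ari 4 M N" for M N
      using that m by (simp add: cong_ari_def)
    have coeff: "bern (2*a) * bern (2*(n - a)) / (24 * real (n - a) * bern (2*n))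
              * of_nat ((2*n) choose (2*a)) * Dab a (n - a) xs =
           1 / (24 * real (n - a)) * (bern (2*a) * bern (2*(n - a)) / bern (2*n))
             * of_nat ((2*n) choose (2*a)) *
             ari (sa (2 * int a + 1)) (ari (sa (2 * int (n - a) + 1)) (sa (-1))) xs
           + 1 / 12 * (bern (2*a) * bern (2*(n - a)) / bern (2*n)) * of_nat ((2*n) choose (2*a)) *
             ari (slang 1 (sa (2 * int a + 1))) (slang 2 (sa (2 * int (n - a)))) xs"
      if "a \<in> {1..<n}" for a xs
      unfolding Dab_def madd_def mscale_def using that by (intro coefficient_split) auto
    have "gen_eq m (msub sigc (xi n)) (\<lambda>xs. \<Sum>a\<in>{1..<n}.
          1 / (24 * real (n - a)) * (bern (2*a) * bern (2*(n - a)) / bern (2*n))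
             * of_nat ((2*n) choose (2*a)) *
          ari (sa (2 * int a + 1)) (ari (sa (2 * int (n - a) + 1)) (sa (-1))) xs)" (is "gen_eq m _ ?U")
      \<comment> \<open>One generic equality suffices here and fills both slots of
        \<open>gen_eq_combine\<close>.\<close>
      by (rule gen_eq_combine[OF gen[OF sigc] gen[OF sigc]])
         (simp add: msub_def madd_def msum_def mscale_def)
    \<comment> \<open>The first claim replaces the leading \<open>slang 1\<close> term of
      \<open>luma\<close> by \<open>xi n\<close>.\<close>
    moreover have "gen_eq m (msub luma (xi n)) (\<lambda>xs. - (\<Sum>a\<in>{1..<n}.
          1 / 12 * (bern (2*a) * bern (2*(n - a)) / bern (2*n)) * of_nat ((2*n) choose (2*a)) *
          ari (slang 1 (sa (2 * int a + 1))) (slang 2 (sa (2 * int (n - a)))) xs))" (is "gen_eq m _ (\<lambda>xs. - ?V xs)")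
      by (rule gen_eq_combine[OF gen[OF luma] gen[OF xi]])
         (simp add: msub_def madd_def msum_def mscale_def)
    ultimately show "gen_eq m (msub sigc luma) ?D"
    proof (rule gen_eq_combine)
      fix xs assume *: "msub sigc (xi n) xs = ?U xs" "msub luma (xi n) xs = - ?V xs"
      have "msub sigc luma xs = ?U xs + ?V xs"
        using * by (simp add: msub_def)
      also have "\<dots> = ?D xs"
        unfolding msum_def mscale_def sum.distrib[symmetric]
        by (intro sum.cong refl) (simp only: coeff)
      finally show "msub sigc luma xs = ?D xs" .
    qed
  qed
next
  fix a assume a: "a \<in> {1..<n}"
  show "in_ari_ge 3 (Dab a (n - a))"
    unfolding in_ari_ge_def by (auto intro!: gen_eq_pointwise simp: Dab_short)
  show "comp_is_qpoly 3 (Dab a (n - a))"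
    using a by (intro Dab_qpoly) auto
qed

end
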